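(* For every integer $s>1$, the constant-free log--exp term $$C(s):=\log_{\log_s((s^s)^s)}\!\left[\log_s\!\left(\left(s^{s^s}\right)^{\left[\log_s\!\left(\left((s^s)^{s^s}\right)^{s^s}\right)\right]^{\log_{\log_s(\log_{s^s}s)}\!\left(\left[\log_s(\log_{s^s}s)\right]^s\right)}}\right)\right]$$ is defined and equals $T(s)$, where $T$ is the shortcut Collatz map $$T(s):=\begin{cases}s/2,&s\text{ even},\\(3s+1)/2,&s\text{ odd}.\end{cases}$$ The term contains $23$ binary operations: $14$ powers and $9$ logarithms, with $s$ as its only leaf symbol.
   Context: Principal values: for $z\in\mathbb{C}\setminus\{0\}$, $\operatorname{Log} z=\log|z|+i\operatorname{Arg} z$ with $\operatorname{Arg} z\in(-\pi,\pi]$. For $x\neq 0$, $x^y:=e^{y\operatorname{Log}x}$; for $a,b\ne0$ with $b\neq1$, $\log_b a:=\operatorname{Log}a/\operatorname{Log}b$. A log--exp term is a finite term built from the two binary operations $x^y$ and $\log_b a$, along with one or more variables and/or constants. It denotes a partial function: an input is outside its domain if any subterm asks for one of the excluded logarithms or bases. Constant-free means that only variables occur as leaves. Operations are counted with multiplicity in the written-out term (as a tree); $s^{s^s}$ means $s^{(s^s)}$. *)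

theory Defs
  imports "HOL-Analysis.Complex_Transcendental"
begin

text \<open>
  The principal logarithm is the library's \<^term>\<open>Ln\<close>, with imaginary part in the half-open
  interval from \<open>-pi\<close> (excluded) to \<open>pi\<close> (included); for \<open>x \<noteq> 0\<close> the library's complex
  \<open>x powr y\<close> is \<open>exp (y * Ln x)\<close>. The library's total extensions (\<open>Ln 0 = 0\<close>,
  \<open>0 powr y = 0\<close>, \<open>z / 0 = 0\<close>) are cut off by returning \<^term>\<open>None\<close>.
\<close>

definition cpow :: "complex \<Rightarrow> complex \<Rightarrow> complex option" where
  "cpow x y = (if x \<noteq> 0 then Some (x powr y) else None)"

definition clog :: "complex \<Rightarrow> complex \<Rightarrow> complex option" where
  "clog b a = (if a \<noteq> 0 \<and> b \<noteq> 0 \<and> b \<noteq> 1 then Some (Ln a / Ln b) else None)"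

text \<open>\<open>s \<up> t\<close> is the power $s^t$, and \<open>Lg b a\<close> is the logarithm of \<open>a\<close> to the base \<open>b\<close>.\<close>

datatype (variables: 'v) log_exp_term =
    Var 'v
  | Const complex
  | Pow "'v log_exp_term" "'v log_exp_term"  (infixr \<open>\<up>\<close> 80)
  | Lg "'v log_exp_term" "'v log_exp_term"

primrec constant_free :: "'v log_exp_term \<Rightarrow> bool" where
  "constant_free (Var v) = True"
| "constant_free (Const c) = False"
| "constant_free (t \<up> u) = (constant_free t \<and> constant_free u)"
| "constant_free (Lg t u) = (constant_free t \<and> constant_free u)"

text \<open>\<^term>\<open>None\<close> propagates, so a term is defined only if all of its subterms are.\<close>

primrec eval_term :: "('v \<Rightarrow> complex) \<Rightarrow> 'v log_exp_term \<Rightarrow> complex option" where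
  "eval_term \<sigma> (Var v) = Some (\<sigma> v)"
| "eval_term \<sigma> (Const c) = Some c"
| "eval_term \<sigma> (t \<up> u) =
     Option.bind (eval_term \<sigma> t) (\<lambda>x. Option.bind (eval_term \<sigma> u) (\<lambda>y. cpow x y))"
| "eval_term \<sigma> (Lg t u) =
     Option.bind (eval_term \<sigma> t) (\<lambda>b. Option.bind (eval_term \<sigma> u) (\<lambda>a. clog b a))"

primrec num_powers :: "'v log_exp_term \<Rightarrow> nat" where
  "num_powers (Var v) = 0"
| "num_powers (Const c) = 0"
| "num_powers (t \<up> u) = Suc (num_powers t + num_powers u)"
| "num_powers (Lg t u) = num_powers t + num_powers u"

primrec num_logs :: "'v log_exp_term \<Rightarrow> nat" where
  "num_logs (Var v) = 0"
| "num_logs (Const c) = 0"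
| "num_logs (t \<up> u) = num_logs t + num_logs u"
| "num_logs (Lg t u) = Suc (num_logs t + num_logs u)"

primrec num_operations :: "'v log_exp_term \<Rightarrow> nat" where
  "num_operations (Var v) = 0"
| "num_operations (Const c) = 0"
| "num_operations (t \<up> u) = Suc (num_operations t + num_operations u)"
| "num_operations (Lg t u) = Suc (num_operations t + num_operations u)"

definition collatz_term :: "'v \<Rightarrow> 'v log_exp_term" where
  "collatz_term v = (let s = Var v in
     Lg (Lg s ((s \<up> s) \<up> s))
        (Lg s ((s \<up> s \<up> s) \<up>
           (Lg s (((s \<up> s) \<up> (s \<up> s)) \<up> (s \<up> s))) \<up>
             Lg (Lg s (Lg (s \<up> s) s))
                ((Lg s (Lg (s \<up> s) s)) \<up> s))))"

text \<open>Both integer divisions are exact.\<close>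

definition shortcut_collatz :: "int \<Rightarrow> int" where
  "shortcut_collatz s = (if even s then s div 2 else (3 * s + 1) div 2)"

end

theory Submission
  imports Defs
begin

text \<open>
  Write \<open>x\<close> for the value of the variable. Apart from one parity test, the term only ever forms
  positive real numbers. Written as \<open>x powr a\<close>, such numbers are raised to a power by multiplying
  \<open>a\<close> (\<open>pow_value\<close>), and their logarithms are quotients of exponents (\<open>log_value\<close>), so this part
  of the term is arithmetic on exponents.

  The parity test (\<open>parity_value\<close>) is where complex numbers enter. Since the logarithm of \<open>x\<close> to
  the base \<open>x powr x\<close> is \<open>1/x\<close>, the logarithm of that number to the base \<open>x\<close> is the constant
  \<open>-1\<close>, built without a constant leaf; and the logarithm of \<open>(-1) powr x\<close> to the base \<open>-1\<close> is a
  bit \<open>p\<close>, \<open>0\<close> for even \<open>x\<close> and \<open>1\<close> for odd \<open>x\<close>. Used as an exponent, \<open>p\<close> switches the factor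
  \<open>x powr (2 * x + 1)\<close> off or on. Multiplying it with \<open>x powr x\<close> gives
  \<open>x powr (x + (2 * x + 1) * p)\<close>, whose exponent is \<open>x\<close> for even \<open>x\<close> and \<open>3 * x + 1\<close> for odd \<open>x\<close>.
  The outermost logarithm, to the base \<open>x\<^sup>2\<close>, halves that exponent.
\<close>

lemma pow_value:
  assumes "eval_term \<sigma> t = Some (of_real (x powr a))" and "eval_term \<sigma> u = Some (of_real b)"
    and "x > 0"
  shows "eval_term \<sigma> (t \<up> u) = Some (of_real (x powr (a * b)))"
  using assms by (simp add: cpow_def powr_of_real powr_powr)

lemma log_value:
  assumes "eval_term \<sigma> t = Some (of_real (x powr b))" and "eval_term \<sigma> u = Some (of_real (x powr a))"
    and "x > 1" and "b \<noteq> 0"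
  shows "eval_term \<sigma> (Lg t u) = Some (of_real (a / b))"
proof -
  have "x powr b \<noteq> 1"
    using assms by (simp add: powr_eq_one_iff_gen)
  then show ?thesis
    using assms by (simp add: clog_def Ln_of_real ln_powr)
qed

text \<open>
  An integer power of \<open>-1\<close> is \<open>1\<close> or \<open>-1\<close>, with principal logarithms \<open>0\<close> and \<open>\<pi> * \<i>\<close>; dividing by
  \<open>Ln (-1) = \<pi> * \<i>\<close> turns the sign into a bit. The choice of branch matters: the continuous
  logarithm \<open>n * \<pi> * \<i>\<close> would give back \<open>n\<close>.
\<close>

lemma parity_value:
  assumes "eval_term \<sigma> t = Some (-1)" and "eval_term \<sigma> u = Some (of_int n)"
  shows "eval_term \<sigma> (Lg t (t \<up> u)) = Some (of_real (of_bool (odd n)))"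
proof -
  have "(-1::complex) powr of_int n = (if even n then 1 else -1)"
    by (simp add: complex_powr_of_int power_int_minus_left)
  then show ?thesis
    using assms by (simp add: cpow_def clog_def)
qed

theorem propositionC1:
  fixes v :: 'v
  shows "(\<forall>(s::int) (\<sigma>::'v \<Rightarrow> complex). s > 1 \<and> \<sigma> v = of_int s \<longrightarrow>
            eval_term \<sigma> (collatz_term v) = Some (of_int (shortcut_collatz s)))
    \<and> constant_free (collatz_term v) \<and> variables (collatz_term v) = {v}
    \<and> num_operations (collatz_term v) = 23
    \<and> num_powers (collatz_term v) = 14
    \<and> num_logs (collatz_term v) = 9"
proof (intro conjI allI impI)
  fix s :: int and \<sigma> :: "'v \<Rightarrow> complex"
  assume s: "s > 1 \<and> \<sigma> v = of_int s"
  define x where "x = real_of_int s"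
  define p :: real where "p = of_bool (odd s)"
  let ?S = "Var v" and ?ev = "eval_term \<sigma>"
  have x: "x > 1" "x > 0"
    using s by (simp_all add: x_def)
  have S: "?ev ?S = Some (of_real x)"
    using s by (simp add: x_def)
  then have S1: "?ev ?S = Some (of_real (x powr 1))"
    using x by simp
  have SS: "?ev (?S \<up> ?S) = Some (of_real (x powr x))"
    using pow_value[OF S1 S x(2)] by simp

  have base: "?ev (Lg ?S ((?S \<up> ?S) \<up> ?S)) = Some (of_real (x powr 2))"
    using log_value[OF S1 pow_value[OF SS S x(2)] x(1)] x by (simp add: power2_eq_square)

  have "?ev (Lg (?S \<up> ?S) ?S) = Some (of_real (1 / x))"
    using log_value[OF SS S1 x(1)] x by simp
  then have "?ev (Lg (?S \<up> ?S) ?S) = Some (of_real (x powr (-1)))"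
    using x by (simp add: powr_minus_divide)
  from log_value[OF S1 this x(1)]
  have "?ev (Lg ?S (Lg (?S \<up> ?S) ?S)) = Some (-1)"
    by simp
  then have bit: "?ev (Lg (Lg ?S (Lg (?S \<up> ?S) ?S)) (Lg ?S (Lg (?S \<up> ?S) ?S) \<up> ?S))
      = Some (of_real p)"
    unfolding p_def by (rule parity_value) (use s in simp)

  have "x powr (2 * x + 1) = x powr x * x powr x * x"
    using x by (simp only: powr_add mult_2 powr_one)
  then have "x * x powr x * x powr x = x powr (2 * x + 1)"
    by (simp only: ac_simps)
  then have factor: "?ev (Lg ?S (((?S \<up> ?S) \<up> (?S \<up> ?S)) \<up> (?S \<up> ?S)))
      = Some (of_real (x powr (2 * x + 1)))"
    using log_value[OF S1 pow_value[OF pow_value[OF SS SS x(2)] SS x(2)] x(1) one_neq_zero]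
    by (simp only: div_by_1)

  \<comment> \<open>Raising \<open>x powr (x powr x)\<close> to the power \<open>q\<close> and taking the logarithm to the base \<open>x\<close> yields
    \<open>x powr x * q\<close>: this is how a language with powers only multiplies.\<close>
  have tower: "?ev (?S \<up> ?S \<up> ?S) = Some (of_real (x powr (x powr x)))"
    using pow_value[OF S1 SS x(2)] by simp
  have arg: "?ev (Lg ?S ((?S \<up> ?S \<up> ?S) \<up>
        Lg ?S (((?S \<up> ?S) \<up> (?S \<up> ?S)) \<up> (?S \<up> ?S)) \<up>
          Lg (Lg ?S (Lg (?S \<up> ?S) ?S)) (Lg ?S (Lg (?S \<up> ?S) ?S) \<up> ?S)))
      = Some (of_real (x powr (x + (2 * x + 1) * p)))"
    using log_value[OF S1 pow_value[OF tower pow_value[OF factor bit x(2)] x(2)] x(1) one_neq_zero]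
    by (simp only: div_by_1 powr_add)

  have "s + (2 * s + 1) * of_bool (odd s) = 2 * shortcut_collatz s"
    unfolding shortcut_collatz_def by (cases "even s") (simp_all, presburger)
  then have "real_of_int (s + (2 * s + 1) * of_bool (odd s)) = real_of_int (2 * shortcut_collatz s)"
    by (rule arg_cong)
  then have "(x + (2 * x + 1) * p) / 2 = real_of_int (shortcut_collatz s)"
    by (simp add: p_def x_def)
  then show "?ev (collatz_term v) = Some (of_int (shortcut_collatz s))"
    using log_value[OF base arg x(1)] unfolding collatz_term_def Let_def
    by (metis of_real_of_int_eq zero_neq_numeral)
qed (simp_all add: collatz_term_def Let_def)

end
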